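(* Let $\mathcal X\subseteq\mathbb R^N$, $\ell\in\{1,\dots,N\}$, $\epsilon\ge0$, and let $\mathbf x_i,\mathbf x_{i'}\in\mathcal X$ be two records that differ only in their $\ell$th coordinate, with $x_{i,\ell}<x_{i',\ell}$. Let $\mathbf y_k$ be an output and let $z(\mathbf y_k\mid\mathbf x_i),z(\mathbf y_k\mid\mathbf x_{i'})>0$ be such that the log-perturbation probabilities satisfy the $(\epsilon,d_1)$-Lipschitz bound $$|\ln z(\mathbf y_k\mid\mathbf x_i)-\ln z(\mathbf y_k\mid\mathbf x_{i'})|\le\epsilon\,d_1(\mathbf x_i,\mathbf x_{i'}).$$ Let $\mathbf x_a,\mathbf x_b\in\mathcal X$ be such that $x_{a,\ell},x_{b,\ell}\in[x_{i,\ell},x_{i',\ell}]$ and all their other coordinates are identical to those of $\mathbf x_i$, and let $\hat z(\mathbf y_k\mid\mathbf x_a)$ and $\hat z(\mathbf y_k\mid\mathbf x_b)$ be the one-dimensional log-convex interpolations from $\big(z(\mathbf y_k\mid\mathbf x_i),z(\mathbf y_k\mid\mathbf x_{i'})\big)$ at $\mathbf x_a$ and $\mathbf x_b$, respectively. Then $$|\ln\hat z(\mathbf y_k\mid\mathbf x_a)-\ln\hat z(\mathbf y_k\mid\mathbf x_b)|\le\epsilon\,d_1(\mathbf x_a,\mathbf x_b).$$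
   Context: $d_1(\mathbf x_a,\mathbf x_b)=\sum_{\ell=1}^N|x_{a,\ell}-x_{b,\ell}|$. One-dimensional log-convex interpolation: if $\mathbf x_i,\mathbf x_{i'}$ differ only in the $\ell$th coordinate with $x_{i,\ell}<x_{i',\ell}$, and $\mathbf x_a$ agrees with them in all coordinates except possibly the $\ell$th, with $x_{a,\ell}\in[x_{i,\ell},x_{i',\ell}]$, then the interpolated value at $\mathbf x_a$ from $\big(z(\mathbf y_k\mid\mathbf x_i),z(\mathbf y_k\mid\mathbf x_{i'})\big)$ is defined by $\ln\hat z(\mathbf y_k\mid\mathbf x_a)=\lambda\ln z(\mathbf y_k\mid\mathbf x_i)+(1-\lambda)\ln z(\mathbf y_k\mid\mathbf x_{i'})$ with $\lambda=\dfrac{x_{i',\ell}-x_{a,\ell}}{x_{i',\ell}-x_{i,\ell}}$. *)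

theory Defs
  imports "HOL-Analysis.Analysis"
begin

definition d1 :: "real ^ 'n \<Rightarrow> real ^ 'n \<Rightarrow> real" where
  "d1 x y = (\<Sum>l\<in>UNIV. \<bar>x $ l - y $ l\<bar>)"

definition interp_weight :: "'n \<Rightarrow> real ^ 'n \<Rightarrow> real ^ 'n \<Rightarrow> real ^ 'n \<Rightarrow> real" where
  "interp_weight l xi xi' xa = (xi' $ l - xa $ l) / (xi' $ l - xi $ l)"

(* The interpolated value v at xa is specified through its logarithm.  Positivity is
   stated explicitly because ln is total in HOL and says nothing useful about v
   outside the positive reals.  Meaningful when xi, xi' and xa agree outside
   coordinate l and xi $ l < xi' $ l, xa $ l \<in> {xi $ l..xi' $ l}. *)
definition log_convex_interp ::
    "'n \<Rightarrow> real ^ 'n \<Rightarrow> real ^ 'n \<Rightarrow> real \<Rightarrow> real \<Rightarrow> real ^ 'n \<Rightarrow> real \<Rightarrow> bool" where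
  "log_convex_interp l xi xi' zi zi' xa v \<longleftrightarrow>
     v > 0 \<and>
     ln v = interp_weight l xi xi' xa * ln zi + (1 - interp_weight l xi xi' xa) * ln zi'"

lemma log_convex_interp_iff_exp:
  "log_convex_interp l xi xi' zi zi' xa v \<longleftrightarrow>
     v = exp (interp_weight l xi xi' xa * ln zi + (1 - interp_weight l xi xi' xa) * ln zi')"
  unfolding log_convex_interp_def by (metis exp_gt_zero exp_ln ln_exp)

end

theory Submission
  imports Defs
begin

text \<open>Along the line through \<open>xi\<close> and \<open>xi'\<close>, the logarithm of the
  interpolated value is an affine function of coordinate \<open>l\<close>, with slope (ln
  \<open>z yk xi'\<close> - ln \<open>z yk xi\<close>) / (\<open>xi' $ l\<close> -
  \<open>xi $ l\<close>). On this line \<open>d1\<close> is just the distance in coordinate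
  \<open>l\<close> (\<open>d1_eq_abs_diff\<close>), so the Lipschitz bound at the two endpoints says
  exactly that the slope is at most \<epsilon> in absolute value. An affine function has the same
  slope between any two points, in particular between \<open>xa\<close> and
  \<open>xb\<close>.\<close>

lemma d1_eq_abs_diff:
  fixes x y :: "real ^ 'n"
  assumes "\<And>m. m \<noteq> l \<Longrightarrow> x $ m = y $ m"
  shows "d1 x y = \<bar>x $ l - y $ l\<bar>"
proof -
  have "d1 x y = (\<Sum>m\<in>{l}. \<bar>x $ m - y $ m\<bar>)"
    unfolding d1_def by (rule sum.mono_neutral_right) (use assms in auto)
  then show ?thesis by simp
qed

theorem proposition1:
  fixes X :: "(real ^ 'n) set"
    and l :: 'n
    and \<epsilon> :: real
    and xi xi' xa xb :: "real ^ 'n"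
    and yk :: 'y
    and z zhat :: "'y \<Rightarrow> real ^ 'n \<Rightarrow> real"
  assumes "\<epsilon> \<ge> 0"
    and "xi \<in> X" and "xi' \<in> X"
    and "\<And>m. m \<noteq> l \<Longrightarrow> xi $ m = xi' $ m"
    and "xi $ l < xi' $ l"
    and "z yk xi > 0" and "z yk xi' > 0"
    and "\<bar>ln (z yk xi) - ln (z yk xi')\<bar> \<le> \<epsilon> * d1 xi xi'"
    and "xa \<in> X" and "xb \<in> X"
    and "xa $ l \<in> {xi $ l..xi' $ l}" and "xb $ l \<in> {xi $ l..xi' $ l}"
    and "\<And>m. m \<noteq> l \<Longrightarrow> xa $ m = xi $ m"
    and "\<And>m. m \<noteq> l \<Longrightarrow> xb $ m = xi $ m"
    and "log_convex_interp l xi xi' (z yk xi) (z yk xi') xa (zhat yk xa)"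
    and "log_convex_interp l xi xi' (z yk xi) (z yk xi') xb (zhat yk xb)"
  shows "\<bar>ln (zhat yk xa) - ln (zhat yk xb)\<bar> \<le> \<epsilon> * d1 xa xb"
proof -
  define A B h where "A = ln (z yk xi)" and "B = ln (z yk xi')" and "h = xi' $ l - xi $ l"
  have h: "h > 0" using assms(5) by (simp add: h_def)
  have AB: "\<bar>A - B\<bar> \<le> \<epsilon> * h"
    using assms(8) d1_eq_abs_diff[of l xi xi'] assms(4,5) by (simp add: A_def B_def h_def)
  have d: "d1 xa xb = \<bar>xa $ l - xb $ l\<bar>"
    by (rule d1_eq_abs_diff) (simp add: assms(13,14))
  \<comment> \<open>Each logarithm has the form B + w * (A - B) with w its weight, so the B terms
    cancel.\<close>
  have "ln (zhat yk xa) - ln (zhat yk xb) =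
      (interp_weight l xi xi' xa - interp_weight l xi xi' xb) * (A - B)"
    using assms(15,16) by (simp add: log_convex_interp_def A_def B_def algebra_simps)
  \<comment> \<open>The order of \<open>xa\<close> and \<open>xb\<close> flips because the weight
    falls as coordinate \<open>l\<close> grows; the absolute value below absorbs the sign.\<close>
  also have "interp_weight l xi xi' xa - interp_weight l xi xi' xb = (xb $ l - xa $ l) / h"
    by (simp add: interp_weight_def h_def diff_divide_distrib)
  finally have "\<bar>ln (zhat yk xa) - ln (zhat yk xb)\<bar> = \<bar>xa $ l - xb $ l\<bar> / h * \<bar>A - B\<bar>"
    using h by (simp add: abs_mult abs_divide abs_minus_commute)
  \<comment> \<open>The endpoint bound enters here; its factor h then cancels the
    denominator.\<close>
  also have "\<dots> \<le> \<bar>xa $ l - xb $ l\<bar> / h * (\<epsilon> * h)"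
    using AB h by (intro mult_left_mono) auto
  also have "\<dots> = \<epsilon> * d1 xa xb"
    using h d by simp
  finally show ?thesis .
qed

end
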